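(* Let $B\in\mathbb{R}^{E\times M}$, $B\ne 0$, and let $b\in\mathbb{R}^E$ be such that $\{w:Bw=b\}\neq\emptyset$. Let $J:\mathbb{R}^M\to\mathbb{R}$ be differentiable, $\delta$-smooth and $\nu$-strongly-convex, and let $w^\star$ be the unique solution of $\min_{w\in\mathbb{R}^M}J(w)$ s.t. $Bw=b$. Suppose the positive step-sizes $\mu_w,\mu_\lambda$ satisfy $$\mu_w<\frac{1}{\delta-\mu_\lambda\sigma_{\min}^2(B)},\qquad \mu_\lambda\le\frac{\nu}{2\sigma_{\max}^2(B)}.$$ Let $w_{-1}\in\mathbb{R}^M$ be arbitrary, $\lambda'_{-1}=0\in\mathbb{R}^E$, and for $i\ge0$ $$w_i=w_{i-1}-\mu_w\big(\nabla J(w_{i-1})+B^{\mathsf T}\lambda'_{i-1}\big),\qquad \lambda'_i=\lambda'_{i-1}+\mu_\lambda(Bw_{i-1}-b).$$ Then $(w_i,\lambda'_i)$ converges linearly to the optimal saddle-point $(w^\star,\lambda_b^\star)$, where $\lambda^\star_b$ is the unique optimal dual variable in the range space of $B$; that is, there exist $C\ge 0$ and $\gamma\in(0,1)$ such that $\|w_i-w^\star\|^2+\|\lambda'_i-\lambda_b^\star\|^2\le C\gamma^i$ for all $i\ge0$.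
   Context: Norms are Euclidean. $\sigma_{\max}(B)$ is the largest singular value of $B$; $\sigma_{\min}^2(B)$ is the smallest eigenvalue of $B^{\mathsf T}B$ (so $\|Bx\|^2\ge\sigma_{\min}^2(B)\|x\|^2$ for all $x\in\mathbb{R}^M$). A differentiable $f$ is $\delta$-smooth ($\delta>0$) if $\|\nabla f(x)-\nabla f(y)\|\le\delta\|x-y\|$ for all $x,y$, and $\nu$-strongly-convex ($\nu>0$) if $(x-y)^{\mathsf T}(\nabla f(x)-\nabla f(y))\ge\nu\|x-y\|^2$ for all $x,y$. An optimal dual variable is a vector $\lambda^\star\in\mathbb{R}^E$ such that $\nabla J(w^\star)+B^{\mathsf T}\lambda^\star=0$ and $Bw^\star=b$; there is exactly one in the range (column) space of $B$. *)

theory Defs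
  imports "HOL-Analysis.Analysis"
begin

definition gradient :: "('a::euclidean_space \<Rightarrow> real) \<Rightarrow> 'a \<Rightarrow> 'a" where
  "gradient f x = (THE D. GDERIV f x :> D)"

lemma gderiv_gradient:
  fixes f :: "'a::euclidean_space \<Rightarrow> real"
  assumes "f differentiable (at x)"
  shows "GDERIV f x :> gradient f x"
proof -
  obtain f' where f': "(f has_derivative f') (at x)"
    using assms by (auto simp: differentiable_def)
  interpret bounded_linear f' using f' by (rule has_derivative_bounded_linear)
  define D where "D = (\<Sum>i\<in>Basis. f' i *\<^sub>R i)"
  have f'_eq: "f' h = inner h D" for h
  proof -
    have "f' h = f' (\<Sum>i\<in>Basis. inner h i *\<^sub>R i)" by (simp only: euclidean_representation)
    also have "\<dots> = (\<Sum>i\<in>Basis. inner h i * f' i)" by (simp only: sum scaleR real_scaleR_def)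
    also have "\<dots> = inner h D" by (simp add: D_def inner_sum_right mult.commute)
    finally show ?thesis .
  qed
  have "f' = (\<lambda>h. inner h D)" using f'_eq by (rule ext)
  then have D: "GDERIV f x :> D" using f' by (simp add: gderiv_def)
  have "D' = D" if "GDERIV f x :> D'" for D'
  proof -
    have "(\<lambda>h. inner h D') = (\<lambda>h. inner h D)"
      using that D unfolding gderiv_def by (rule has_derivative_unique)
    then have "\<forall>h. inner h D' = inner h D" by meson
    then show ?thesis by (simp only: vector_eq_ldot)
  qed
  with D have "gradient f x = D" unfolding gradient_def by (rule the_equality)
  with D show ?thesis by simp
qed

definition smooth_with :: "real \<Rightarrow> ('a::euclidean_space \<Rightarrow> real) \<Rightarrow> bool" where
  "smooth_with \<delta> f \<longleftrightarrow> \<delta> > 0 \<and> f differentiable_on UNIV \<and>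
     (\<forall>x y. norm (gradient f x - gradient f y) \<le> \<delta> * norm (x - y))"

definition strongly_convex_with :: "real \<Rightarrow> ('a::euclidean_space \<Rightarrow> real) \<Rightarrow> bool" where
  "strongly_convex_with \<nu> f \<longleftrightarrow> \<nu> > 0 \<and> f differentiable_on UNIV \<and>
     (\<forall>x y. (x - y) \<bullet> (gradient f x - gradient f y) \<ge> \<nu> * (norm (x - y))\<^sup>2)"

definition eigenvalues :: "real ^ 'n ^ 'n \<Rightarrow> real set" where
  "eigenvalues A = {c. \<exists>v. v \<noteq> 0 \<and> A *v v = c *\<^sub>R v}"

definition singular_values :: "real ^ 'm ^ 'e \<Rightarrow> real set" where
  "singular_values B = sqrt ` eigenvalues (transpose B ** B)"

definition sigma_max :: "real ^ 'm ^ 'e \<Rightarrow> real" where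
  "sigma_max B = Max (singular_values B)"

text \<open>The minimum runs over all eigenvalues of the square matrix \<open>B\<^sup>T B\<close>, so it is \<open>0\<close>
  whenever \<open>B\<close> has a nontrivial kernel, in particular when \<open>B\<close> has more columns than rows.\<close>

definition sigma_min_sq :: "real ^ 'm ^ 'e \<Rightarrow> real" where
  "sigma_min_sq B = Min (eigenvalues (transpose B ** B))"

definition constrained_minimizer ::
    "(real ^ 'm \<Rightarrow> real) \<Rightarrow> real ^ 'm ^ 'e \<Rightarrow> real ^ 'e \<Rightarrow> real ^ 'm \<Rightarrow> bool" where
  "constrained_minimizer J B b ws \<longleftrightarrow> B *v ws = b \<and> (\<forall>w. B *v w = b \<longrightarrow> J ws \<le> J w)"

definition optimal_dual ::
    "(real ^ 'm \<Rightarrow> real) \<Rightarrow> real ^ 'm ^ 'e \<Rightarrow> real ^ 'e \<Rightarrow> real ^ 'm \<Rightarrow> real ^ 'e \<Rightarrow> bool" where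
  "optimal_dual J B b ws l \<longleftrightarrow> gradient J ws + transpose B *v l = 0 \<and> B *v ws = b"

end

theory Submission
  imports Defs
begin

text \<open>Put \<open>\<lambda>\<^sub>n = \<lambda>'\<^sub>n\<^sub>+\<^sub>1\<close>. Substituting the dual update into the primal one turns the
  recursion into the incremental one, \<open>w\<^sub>n = w\<^sub>n\<^sub>-\<^sub>1 - \<mu>\<^sub>w (g w\<^sub>n\<^sub>-\<^sub>1 + B\<^sup>T \<lambda>\<^sub>n\<^sub>-\<^sub>1)\<close>,
  \<open>\<lambda>\<^sub>n = \<lambda>\<^sub>n\<^sub>-\<^sub>1 + \<mu>\<^sub>l (B w\<^sub>n - b)\<close>, where \<open>g\<close> is the gradient of
  \<open>J - (\<mu>\<^sub>l/2) \<parallel>B w - b\<parallel>\<^sup>2\<close>. The step-size conditions keep this function strongly convex, and its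
  gradient is cocoercive with constant \<open>\<delta> - \<mu>\<^sub>l \<sigma>\<^sub>m\<^sub>i\<^sub>n\<^sup>2\<close>. For the errors \<open>x, y\<close> of the two
  variables, \<open>\<parallel>x\<parallel>\<^sup>2 - \<mu>\<^sub>w \<mu>\<^sub>l \<parallel>B x\<parallel>\<^sup>2 + (\<mu>\<^sub>w/\<mu>\<^sub>l) \<parallel>y\<parallel>\<^sup>2\<close> is then equivalent to the squared norm
  and contracts, since the dual errors stay in the range of \<open>B\<close>, on which \<open>B\<^sup>T\<close> is
  bounded below.\<close>

section \<open>Cocoercivity of gradients\<close>

text \<open>The mean value theorem on the segment from \<open>x\<close> to \<open>y\<close> gives
  the slope at a point \<open>x + t *\<^sub>R d\<close>; monotonicity compares it with the slope at
  \<open>x\<close> once the factor \<open>t > 0\<close> is cancelled.\<close>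

lemma monotone_gderiv_imp_above_tangent:
  fixes f :: "'a::real_inner \<Rightarrow> real"
  assumes f: "\<And>x. GDERIV f x :> g x"
    and mono: "\<And>x y. 0 \<le> (x - y) \<bullet> (g x - g y)"
  shows "f x + (y - x) \<bullet> g x \<le> f y"
proof -
  define d where "d = y - x"
  have deriv: "((\<lambda>t. f (x + t *\<^sub>R d)) has_real_derivative d \<bullet> g (x + t *\<^sub>R d)) (at t)" for t
  proof -
    have "((\<lambda>t. x + t *\<^sub>R d) has_derivative (\<lambda>h. h *\<^sub>R d)) (at t)"
      by (auto intro!: derivative_eq_intros)
    from has_derivative_compose[OF this f[unfolded gderiv_def]]
    show ?thesis
      by (simp add: has_field_derivative_def mult.commute[of _ "d \<bullet> g (x + t *\<^sub>R d)"])
  qed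
  obtain t :: real where t: "0 < t" "f (x + 1 *\<^sub>R d) - f (x + 0 *\<^sub>R d) = (1 - 0) * (d \<bullet> g (x + t *\<^sub>R d))"
    using MVT2[of 0 1 "\<lambda>t. f (x + t *\<^sub>R d)" "\<lambda>t. d \<bullet> g (x + t *\<^sub>R d)"] deriv by auto
  have "0 \<le> t * (d \<bullet> (g (x + t *\<^sub>R d) - g x))"
    using mono[of "x + t *\<^sub>R d" x] by simp
  with t(1) have "d \<bullet> g x \<le> d \<bullet> g (x + t *\<^sub>R d)"
    by (simp add: zero_le_mult_iff inner_diff_right)
  with t(2) show ?thesis by (simp add: d_def)
qed

text \<open>Both \<open>f\<close> and \<open>L / 2 * (z \<bullet> z) - f z\<close> have monotone
  gradients, so each lies above its tangents. The upper bound concerns the inner product only, the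
  form that is at hand after subtracting a quadratic penalty.\<close>

lemma gderiv_cocoercive:
  fixes f :: "'a::real_inner \<Rightarrow> real"
  assumes f: "\<And>x. GDERIV f x :> g x" and "L > 0"
    and mono: "\<And>x y. 0 \<le> (x - y) \<bullet> (g x - g y)"
    and upper: "\<And>x y. (x - y) \<bullet> (g x - g y) \<le> L * (norm (x - y))\<^sup>2"
  shows "(norm (g x - g y))\<^sup>2 \<le> L * ((x - y) \<bullet> (g x - g y))"
proof -
  \<comment> \<open>The tangent inequality for \<open>h\<close> is the quadratic upper bound on
    \<open>f\<close>.\<close>
  define h where "h z = L / 2 * (z \<bullet> z) - f z" for z
  have h: "GDERIV h z :> L *\<^sub>R z - g z" for z
    unfolding h_def gderiv_def
    by (rule derivative_eq_intros f[unfolded gderiv_def] refl)+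
      (simp add: inner_diff_right inner_commute fun_eq_iff)
  have h_mono: "0 \<le> (x - y) \<bullet> ((L *\<^sub>R x - g x) - (L *\<^sub>R y - g y))" for x y
    using upper[of x y]
    by (simp add: power2_norm_eq_inner inner_diff_left inner_diff_right algebra_simps)
  have half: "(norm (g x - g y))\<^sup>2 / (2 * L) \<le> f y - f x - (y - x) \<bullet> g x" for x y
  proof -
    define r where "r = g y - g x"
    \<comment> \<open>a gradient step from \<open>y\<close> for \<open>\<lambda>z. f z - g x \<bullet> z\<close>, which is minimal at \<open>x\<close>\<close>
    define z where "z = y - (1 / L) *\<^sub>R r"
    have "f x + (z - x) \<bullet> g x \<le> f z"
      by (rule monotone_gderiv_imp_above_tangent[OF f mono])
    moreover have "h y + (z - y) \<bullet> (L *\<^sub>R y - g y) \<le> h z"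
      by (rule monotone_gderiv_imp_above_tangent[OF h h_mono])
    moreover have "h z - h y - (z - y) \<bullet> (L *\<^sub>R y - g y)
        = (r \<bullet> r) / (2 * L) - f z + f y - (r \<bullet> g y) / L"
      using \<open>L > 0\<close>
      by (simp add: h_def z_def inner_diff_left inner_diff_right inner_commute field_simps)
    moreover have "(z - x) \<bullet> g x = (y - x) \<bullet> g x - (r \<bullet> g x) / L"
      by (simp add: z_def inner_diff_left algebra_simps)
    moreover have "(r \<bullet> g y) / L - (r \<bullet> g x) / L = (r \<bullet> r) / L"
      by (simp add: r_def inner_diff_right diff_divide_distrib)
    moreover have "(r \<bullet> r) / L = 2 * ((r \<bullet> r) / (2 * L))" by simp
    moreover have "(norm (g x - g y))\<^sup>2 / (2 * L) = (r \<bullet> r) / (2 * L)"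
      by (simp add: r_def power2_norm_eq_inner inner_diff_left inner_diff_right inner_commute)
    ultimately show ?thesis by linarith
  qed
  \<comment> \<open>Adding the estimates for \<open>(x, y)\<close> and \<open>(y, x)\<close> cancels
    the function values.\<close>
  have "(norm (g x - g y))\<^sup>2 / (2 * L) + (norm (g y - g x))\<^sup>2 / (2 * L)
      \<le> (x - y) \<bullet> (g x - g y)"
    using half[of x y] half[of y x] by (simp add: inner_diff_left inner_diff_right)
  then have "(norm (g x - g y))\<^sup>2 / L \<le> (x - y) \<bullet> (g x - g y)"
    by (simp add: norm_minus_commute)
  with \<open>L > 0\<close> show ?thesis by (simp add: field_simps)
qed

section \<open>Extreme eigenvalues of Gram matrices\<close>

lemma transpose_mult_inner: "(transpose B *v y) \<bullet> x = y \<bullet> (B *v x)" for B :: "real ^ 'm ^ 'e"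
  by (simp only: transpose_matrix_vector dot_lmul_matrix)

lemma gram_inner: "((transpose B ** B) *v y) \<bullet> x = (B *v y) \<bullet> (B *v x)" for B :: "real ^ 'm ^ 'e"
  by (simp only: matrix_vector_mul_assoc[symmetric] transpose_mult_inner)

text \<open>If \<open>f v\<close> were nonzero, a short step from \<open>v\<close> along
  \<open>- f v\<close> would make the form negative, since its first-order change is
  negative.\<close>

lemma psd_form_zero_imp_kernel:
  fixes f :: "'a::real_inner \<Rightarrow> 'a"
  assumes f: "linear f" and sym: "\<And>x y. f x \<bullet> y = x \<bullet> f y"
    and psd: "\<And>x. 0 \<le> x \<bullet> f x" and v: "v \<bullet> f v = 0"
  shows "f v = 0"
proof -
  define p where "p = f v \<bullet> f v"
  define q where "q = f v \<bullet> f (f v)"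
  have "0 \<le> q" by (simp add: q_def psd)
  show ?thesis
  proof (rule ccontr)
    assume "f v \<noteq> 0"
    then have "0 < p" by (simp add: p_def)
    \<comment> \<open>The \<open>+ 1\<close> keeps the denominator positive even for
      \<open>q = 0\<close> and yields \<open>t * q < p\<close>.\<close>
    define t where "t = p / (q + 1)"
    have t: "0 < t" "t * q < p"
      using \<open>0 < p\<close> \<open>0 \<le> q\<close> by (simp_all add: t_def field_simps)
    have "0 \<le> (v - t *\<^sub>R f v) \<bullet> f (v - t *\<^sub>R f v)" by (rule psd)
    also have "\<dots> = t * (t * q - 2 * p)"
      using v sym[of v "f v"]
      by (simp add: linear_diff[OF f] linear_cmul[OF f] inner_diff_left inner_diff_right p_def q_def
          algebra_simps)
    finally show False using t \<open>0 < p\<close> by (simp add: zero_le_mult_iff)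
  qed
qed

text \<open>Eigenvectors of distinct eigenvalues are orthogonal, so one per eigenvalue forms an
  independent set. Finiteness gives \<open>Min\<close> and \<open>Max\<close> in
  \<open>sigma_min_sq\<close> and \<open>sigma_max\<close> their meaning.\<close>

lemma finite_eigenvalues_gram:
  fixes B :: "real ^ 'm ^ 'e"
  shows "finite (eigenvalues (transpose B ** B))"
proof -
  let ?A = "transpose B ** B"
  let ?E = "eigenvalues ?A"
  have "\<forall>c\<in>?E. \<exists>v. v \<noteq> 0 \<and> ?A *v v = c *\<^sub>R v" by (simp add: eigenvalues_def)
  then obtain v where v: "\<And>c. c \<in> ?E \<Longrightarrow> v c \<noteq> 0 \<and> ?A *v v c = c *\<^sub>R v c" by metis
  have orth: "v c \<bullet> v d = 0" if "c \<in> ?E" "d \<in> ?E" "c \<noteq> d" for c d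
  proof -
    have "c * (v c \<bullet> v d) = (?A *v v c) \<bullet> v d" using v that by simp
    also have "\<dots> = (?A *v v d) \<bullet> v c" by (simp only: gram_inner[of B] inner_commute[of "B *v v c"])
    also have "\<dots> = d * (v c \<bullet> v d)" using v that by (simp add: inner_commute)
    finally show ?thesis using that by simp
  qed
  have "inj_on v ?E"
    by (rule inj_onI) (metis orth v inner_eq_zero_iff)
  moreover have "pairwise orthogonal (v ` ?E)"
    using orth by (auto simp: pairwise_def orthogonal_def)
  then have "independent (v ` ?E)"
    by (rule pairwise_orthogonal_independent) (use v in auto)
  then have "finite (v ` ?E)" by (rule independent_imp_finite)
  ultimately show ?thesis using finite_imageD by blast
qed

text \<open>Compactness of the unit sphere provides the extremal vectors; homogeneity extends the
  bounds to all \<open>x\<close>.\<close>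

lemma norm_mult_attains_bounds:
  fixes B :: "real ^ 'm ^ 'e"
  obtains u v where "norm u = 1" "norm v = 1"
    "\<And>x. (norm (B *v u))\<^sup>2 * (norm x)\<^sup>2 \<le> (norm (B *v x))\<^sup>2"
    "\<And>x. (norm (B *v x))\<^sup>2 \<le> (norm (B *v v))\<^sup>2 * (norm x)\<^sup>2"
proof -
  let ?S = "sphere (0 :: real ^ 'm) 1"
  have ne: "?S \<noteq> {}" by simp
  have cont: "continuous_on ?S (\<lambda>x. norm (B *v x))"
    by (intro continuous_intros matrix_vector_mult_linear_continuous_on)
  obtain v where v: "v \<in> ?S" "\<forall>x\<in>?S. norm (B *v x) \<le> norm (B *v v)"
    using continuous_attains_sup[OF compact_sphere ne cont] by blast
  obtain u where u: "u \<in> ?S" "\<forall>x\<in>?S. norm (B *v u) \<le> norm (B *v x)"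
    using continuous_attains_inf[OF compact_sphere ne cont] by blast
  have bounds: "norm (B *v u) * norm x \<le> norm (B *v x)" "norm (B *v x) \<le> norm (B *v v) * norm x"
    for x
  proof -
    have "norm (B *v u) * norm x \<le> norm (B *v x) \<and> norm (B *v x) \<le> norm (B *v v) * norm x"
    proof (cases "x = 0")
      case False
      then have mem: "(1 / norm x) *\<^sub>R x \<in> ?S" by simp
      have "norm (B *v ((1 / norm x) *\<^sub>R x)) = norm (B *v x) / norm x"
        by (simp add: matrix_vector_mult_scaleR)
      with u(2) v(2) mem False show ?thesis by (metis le_divide_eq divide_le_eq zero_less_norm_iff)
    qed simp
    then show "norm (B *v u) * norm x \<le> norm (B *v x)" "norm (B *v x) \<le> norm (B *v v) * norm x"
      by auto
  qed
  show ?thesis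
  proof (rule that)
    show "norm u = 1" "norm v = 1" using u v by auto
    show "(norm (B *v u))\<^sup>2 * (norm x)\<^sup>2 \<le> (norm (B *v x))\<^sup>2"
      "(norm (B *v x))\<^sup>2 \<le> (norm (B *v v))\<^sup>2 * (norm x)\<^sup>2" for x
      using power_mono[OF bounds(1)[of x], of 2] power_mono[OF bounds(2)[of x], of 2]
      by (simp_all add: power_mult_distrib)
  qed
qed

text \<open>For the Gram matrix \<open>A\<close> and the extreme values \<open>c\<close>,
  \<open>d\<close> of the squared norm of \<open>B *v x\<close> on the unit sphere,
  \<open>A - c\<close> and \<open>d - A\<close> are positive semidefinite with forms vanishing at
  \<open>u\<close> and \<open>v\<close>. Hence \<open>c\<close> and \<open>d\<close> are
  eigenvalues, comparable with \<open>Min\<close> and \<open>Max\<close>.\<close>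

lemma sigma_bounds:
  fixes B :: "real ^ 'm ^ 'e"
  shows "sigma_min_sq B * (norm x)\<^sup>2 \<le> (norm (B *v x))\<^sup>2"
    and "(norm (B *v x))\<^sup>2 \<le> (sigma_max B)\<^sup>2 * (norm x)\<^sup>2"
proof -
  let ?A = "transpose B ** B"
  let ?E = "eigenvalues ?A"
  obtain u v where uv: "norm u = 1" "norm v = 1"
    and lower: "\<And>x. (norm (B *v u))\<^sup>2 * (norm x)\<^sup>2 \<le> (norm (B *v x))\<^sup>2"
    and upper: "\<And>x. (norm (B *v x))\<^sup>2 \<le> (norm (B *v v))\<^sup>2 * (norm x)\<^sup>2"
    by (rule norm_mult_attains_bounds[of B]) blast
  define c where "c = (norm (B *v u))\<^sup>2"
  define d where "d = (norm (B *v v))\<^sup>2"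
  note lin = matrix_vector_right_distrib matrix_vector_mult_scaleR algebra_simps
  have sq: "x \<bullet> (?A *v y) = (B *v x) \<bullet> (B *v y)" for x y
    using gram_inner[of B y x] by (simp only: inner_commute)
  have "?A *v u - c *\<^sub>R u = 0"
  proof (rule psd_form_zero_imp_kernel[where f = "\<lambda>x. ?A *v x - c *\<^sub>R x"])
    show "linear (\<lambda>x. ?A *v x - c *\<^sub>R x)" by (intro linearI) (simp_all add: lin)
  qed (use uv lower in \<open>simp_all add: inner_diff_left inner_diff_right sq gram_inner
        c_def dot_square_norm\<close>)
  then have "c \<in> ?E" using uv by (auto simp: eigenvalues_def intro!: exI[of _ u])
  have "d *\<^sub>R v - ?A *v v = 0"
  proof (rule psd_form_zero_imp_kernel[where f = "\<lambda>x. d *\<^sub>R x - ?A *v x"])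
    show "linear (\<lambda>x. d *\<^sub>R x - ?A *v x)" by (intro linearI) (simp_all add: lin)
  qed (use uv upper in \<open>simp_all add: inner_diff_left inner_diff_right sq gram_inner
        d_def dot_square_norm\<close>)
  then have "d \<in> ?E" using uv by (auto simp: eigenvalues_def intro!: exI[of _ v])
  have "sigma_min_sq B \<le> c"
    unfolding sigma_min_sq_def by (rule Min_le[OF finite_eigenvalues_gram \<open>c \<in> ?E\<close>])
  then have "sigma_min_sq B * (norm x)\<^sup>2 \<le> c * (norm x)\<^sup>2" by (rule mult_right_mono) simp
  with lower show "sigma_min_sq B * (norm x)\<^sup>2 \<le> (norm (B *v x))\<^sup>2"
    unfolding c_def by (rule order_trans[rotated])
  have "sqrt d \<le> sigma_max B"
    unfolding sigma_max_def singular_values_def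
    by (rule Max_ge) (use finite_eigenvalues_gram \<open>d \<in> ?E\<close> in auto)
  then have "d \<le> (sigma_max B)\<^sup>2"
    by (rule sqrt_le_D)
  then have "d * (norm x)\<^sup>2 \<le> (sigma_max B)\<^sup>2 * (norm x)\<^sup>2" by (rule mult_right_mono) simp
  with upper show "(norm (B *v x))\<^sup>2 \<le> (sigma_max B)\<^sup>2 * (norm x)\<^sup>2"
    unfolding d_def by (rule order_trans)
qed

section \<open>The dual variable in the range of \<open>B\<close>\<close>

lemma subspace_range_mult: "subspace (range (\<lambda>x. B *v x))" for B :: "real ^ 'm ^ 'e"
  by (rule linear_subspace_image[OF matrix_vector_mul_linear subspace_UNIV])

lemma transpose_mult_inj_on_range:
  fixes B :: "real ^ 'm ^ 'e"
  assumes "y \<in> range (\<lambda>x. B *v x)" "transpose B *v y = 0"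
  shows "y = 0"
proof -
  obtain x where x: "y = B *v x" using assms(1) by auto
  have "y \<bullet> y = 0" using transpose_mult_inner[of B y x] unfolding assms(2) x[symmetric] by simp
  then show ?thesis by simp
qed

text \<open>An injective linear map on a closed finite-dimensional subspace is bounded below. This
  makes the dual error contract even when \<open>B\<close> is rank deficient.\<close>

lemma transpose_mult_bounded_below_on_range:
  fixes B :: "real ^ 'm ^ 'e"
  obtains c where "c > 0"
    "\<And>y. y \<in> range (\<lambda>x. B *v x) \<Longrightarrow> c * (norm y)\<^sup>2 \<le> (norm (transpose B *v y))\<^sup>2"
proof -
  have "\<exists>e>0. \<forall>y\<in>range (\<lambda>x. B *v x). e * norm y \<le> norm (transpose B *v y)"
    using closed_subspace subspace_range_mult matrix_vector_mul_bounded_linear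
    by (rule injective_imp_isometric) (use subspace_range_mult transpose_mult_inj_on_range in blast)+
  then obtain e where e: "e > 0"
    "\<And>y. y \<in> range (\<lambda>x. B *v x) \<Longrightarrow> e * norm y \<le> norm (transpose B *v y)"
    by blast
  show ?thesis
  proof (rule that)
    show "e\<^sup>2 > 0" using e(1) by simp
    show "e\<^sup>2 * (norm y)\<^sup>2 \<le> (norm (transpose B *v y))\<^sup>2" if "y \<in> range (\<lambda>x. B *v x)" for y
      using power_mono[OF e(2)[OF that], of 2] e(1) by (simp add: power_mult_distrib)
  qed
qed

text \<open>Moving from \<open>ws\<close> along a kernel vector stays feasible, so the derivative of
  \<open>J\<close> along that line vanishes.\<close>

lemma constrained_minimizer_gradient_orthogonal:
  assumes "J differentiable_on UNIV" "constrained_minimizer J B b ws" "B *v z = 0"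
  shows "z \<bullet> gradient J ws = 0"
proof -
  have J: "(J has_derivative (\<lambda>h. h \<bullet> gradient J ws)) (at (ws + 0 *\<^sub>R z))"
    using gderiv_gradient[of J ws] assms(1) by (simp add: gderiv_def differentiable_on_def)
  have "((\<lambda>t. ws + t *\<^sub>R z) has_derivative (\<lambda>h. h *\<^sub>R z)) (at (0::real))"
    by (auto intro!: derivative_eq_intros)
  from has_derivative_compose[OF this J]
  have "((\<lambda>t. J (ws + t *\<^sub>R z)) has_real_derivative z \<bullet> gradient J ws) (at 0)"
    by (simp add: has_field_derivative_def mult.commute[of _ "z \<bullet> gradient J ws"])
  moreover have "J (ws + 0 *\<^sub>R z) \<le> J (ws + t *\<^sub>R z)" for t
    using assms(2,3)
    by (simp add: constrained_minimizer_def matrix_vector_right_distrib matrix_vector_mult_scaleR)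
  ultimately show ?thesis
    using DERIV_local_min[of "\<lambda>t. J (ws + t *\<^sub>R z)" _ 0 1] by simp
qed

text \<open>The part \<open>z\<close> of the gradient orthogonal to the range of
  \<open>B\<^sup>T\<close> lies in the kernel of \<open>B\<close>, hence is orthogonal to the
  gradient and so to itself.\<close>

lemma optimal_dual_in_range_exists:
  assumes "J differentiable_on UNIV" "constrained_minimizer J B b ws"
  obtains lb where "optimal_dual J B b ws lb" "lb \<in> range (\<lambda>x. B *v x)"
proof -
  have "\<exists>y\<in>range (\<lambda>l. transpose B *v l). \<exists>z.
      (\<forall>l. z \<bullet> (transpose B *v l) = 0) \<and> gradient J ws = y + z"
    using orthogonal_subspace_decomp_exists[of "range (\<lambda>l. transpose B *v l)" "gradient J ws"]
    unfolding span_eq_iff[THEN iffD2, OF subspace_range_mult] orthogonal_def by (metis rangeI)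
  then obtain k z where z: "\<And>l. z \<bullet> (transpose B *v l) = 0"
    and eq: "gradient J ws = transpose B *v k + z" by auto
  have "(B *v z) \<bullet> (B *v z) = 0"
    using z[of "B *v z"] by (simp only: inner_commute[of z] transpose_mult_inner)
  then have "z \<bullet> gradient J ws = 0"
    by (intro constrained_minimizer_gradient_orthogonal[OF assms]) simp
  then have "z = 0" using z by (simp add: eq inner_add_right)
  obtain p q where p: "p \<in> range (\<lambda>x. B *v x)" and q: "\<And>x. q \<bullet> (B *v x) = 0" and k: "k = p + q"
    using orthogonal_subspace_decomp_exists[of "range (\<lambda>x. B *v x)" k]
    unfolding span_eq_iff[THEN iffD2, OF subspace_range_mult] orthogonal_def by (metis rangeI)
  have "(transpose B *v q) \<bullet> (transpose B *v q) = 0" by (simp only: transpose_mult_inner q)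
  then have "gradient J ws = transpose B *v p"
    by (simp add: eq \<open>z = 0\<close> k matrix_vector_right_distrib)
  then have "optimal_dual J B b ws (- p)"
    using assms(2)
    by (simp add: optimal_dual_def constrained_minimizer_def linear_neg[OF matrix_vector_mul_linear])
  moreover have "- p \<in> range (\<lambda>x. B *v x)" using p subspace_range_mult by (rule subspace_neg[rotated])
  ultimately show ?thesis by (rule that)
qed

lemma optimal_dual_in_range_unique:
  assumes "optimal_dual J B b ws k" "k \<in> range (\<lambda>x. B *v x)"
    and "optimal_dual J B b ws l" "l \<in> range (\<lambda>x. B *v x)"
  shows "k = l"
proof -
  have "k - l = 0"
  proof (rule transpose_mult_inj_on_range)
    show "k - l \<in> range (\<lambda>x. B *v x)"
      by (rule subspace_diff[OF subspace_range_mult assms(2,4)])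
    have "gradient J ws + transpose B *v k = gradient J ws + transpose B *v l"
      using assms(1,3) by (simp add: optimal_dual_def)
    then show "transpose B *v (k - l) = 0" by (simp add: matrix_vector_mult_diff_distrib)
  qed
  then show ?thesis by simp
qed

section \<open>Contraction\<close>

text \<open>The term in \<open>B *v x\<close> and the weight \<open>\<mu> / \<eta>\<close> are tuned
  to cancel the quadratic and cross terms created by the dual update.\<close>

definition lyapunov :: "real ^ 'm ^ 'e \<Rightarrow> real \<Rightarrow> real \<Rightarrow> real ^ 'm \<Rightarrow> real ^ 'e \<Rightarrow> real" where
  "lyapunov B \<mu> \<eta> x y = (norm x)\<^sup>2 - \<mu> * \<eta> * (norm (B *v x))\<^sup>2 + \<mu> / \<eta> * (norm y)\<^sup>2"

text \<open>The negative term is at most \<open>\<mu> * m\<close> times the squared norm of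
  \<open>x\<close>, because \<open>\<eta> * s \<le> m\<close>.\<close>

lemma lyapunov_lower:
  assumes "0 < \<mu>" "0 < \<eta>" "\<mu> * m < 1" "\<eta> * s \<le> m" "(norm (B *v x))\<^sup>2 \<le> s * (norm x)\<^sup>2"
  shows "(1 - \<mu> * m) * (norm x)\<^sup>2 + \<mu> / \<eta> * (norm y)\<^sup>2 \<le> lyapunov B \<mu> \<eta> x y"
proof -
  have "\<mu> * \<eta> * (norm (B *v x))\<^sup>2 \<le> \<mu> * \<eta> * (s * (norm x)\<^sup>2)"
    using assms by (intro mult_left_mono) auto
  also have "\<dots> = (\<mu> * (norm x)\<^sup>2) * (\<eta> * s)" by simp
  also have "\<dots> \<le> (\<mu> * (norm x)\<^sup>2) * m" using assms by (intro mult_left_mono) auto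
  finally show ?thesis by (simp add: lyapunov_def algebra_simps)
qed

text \<open>An exact identity: \<open>y'\<close> uses the new \<open>x'\<close>, so the cross term
  \<open>2 * \<mu> * (p \<bullet> u)\<close> from the dual part cancels the one from the primal
  part, leaving a net decrease in \<open>p\<close>.\<close>

lemma lyapunov_step:
  assumes "0 < \<mu>" "0 < \<eta>"
    and x': "x' = x - \<mu> *\<^sub>R (d + transpose B *v y)" and y': "y' = y + \<eta> *\<^sub>R (B *v x')"
  shows "lyapunov B \<mu> \<eta> x' y' =
    (norm (x - \<mu> *\<^sub>R d))\<^sup>2 - \<mu>\<^sup>2 * (norm (transpose B *v y))\<^sup>2 + \<mu> / \<eta> * (norm y)\<^sup>2"
proof -
  define p where "p = transpose B *v y"
  define u where "u = x - \<mu> *\<^sub>R d"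
  have xu: "x' = u - \<mu> *\<^sub>R p" by (simp add: x' u_def p_def algebra_simps)
  have yB: "y \<bullet> (B *v x') = p \<bullet> u - \<mu> * (p \<bullet> p)"
    unfolding transpose_mult_inner[symmetric] p_def[symmetric] xu
    by (simp add: inner_diff_right)
  have ny: "(norm y')\<^sup>2 = (norm y)\<^sup>2 + 2 * \<eta> * (p \<bullet> u - \<mu> * (p \<bullet> p)) + \<eta>\<^sup>2 * (norm (B *v x'))\<^sup>2"
    unfolding y' yB[symmetric] power2_norm_eq_inner
    by (simp add: inner_add_left inner_add_right inner_commute power2_eq_square
        algebra_simps)
  have nx: "(norm x')\<^sup>2 = (norm u)\<^sup>2 - 2 * \<mu> * (p \<bullet> u) + \<mu>\<^sup>2 * (p \<bullet> p)"
    unfolding xu power2_norm_eq_inner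
    by (simp add: inner_diff_left inner_diff_right inner_commute
        power2_eq_square algebra_simps)
  show ?thesis
    unfolding lyapunov_def p_def[symmetric] u_def[symmetric] nx ny dot_square_norm
    using assms(1,2) by (simp add: field_simps power2_eq_square)
qed

text \<open>By \<open>lyapunov_step\<close> the primal and dual errors decouple. Each is contracted
  relative to its coefficient in the lower bound \<open>lyapunov_lower\<close>; \<open>d\<close>
  stands for a gradient difference.\<close>

lemma lyapunov_contraction:
  fixes B :: "real ^ 'm ^ 'e" and \<mu> \<eta> m L s :: real
  assumes pos: "0 < \<mu>" "0 < \<eta>" "0 < m" and mL: "m \<le> L" and \<mu>: "\<mu> * L < 1" and \<eta>: "\<eta> * s \<le> m"
    and B: "\<And>x. (norm (B *v x))\<^sup>2 \<le> s * (norm x)\<^sup>2"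
  obtains \<gamma> where "0 < \<gamma>" "\<gamma> < 1"
    "\<And>x y d x' y'. \<lbrakk>m * (norm x)\<^sup>2 \<le> x \<bullet> d; (norm d)\<^sup>2 \<le> L * (x \<bullet> d);
        y \<in> range (\<lambda>x. B *v x); x' = x - \<mu> *\<^sub>R (d + transpose B *v y);
        y' = y + \<eta> *\<^sub>R (B *v x')\<rbrakk> \<Longrightarrow> lyapunov B \<mu> \<eta> x' y' \<le> \<gamma> * lyapunov B \<mu> \<eta> x y"
proof -
  obtain c where c: "c > 0"
    "\<And>y. y \<in> range (\<lambda>x. B *v x) \<Longrightarrow> c * (norm y)\<^sup>2 \<le> (norm (transpose B *v y))\<^sup>2"
    by (rule transpose_mult_bounded_below_on_range[of B]) blast
  define a where "a = \<mu> * m"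
  have "\<mu> * m \<le> \<mu> * L" using mL pos by simp
  with \<mu> have "a < 1" unfolding a_def by linarith
  with pos have a: "0 < a" "a < 1" by (simp_all add: a_def)
  \<comment> \<open>The primal decrease factor relative to the coefficient \<open>1 - a\<close> of
    the lower bound; it is below 1 because \<open>2 - \<mu> * L > 1\<close>.\<close>
  define r where "r = (1 - a * (2 - \<mu> * L)) / (1 - a)"
  have "a * 1 < a * (2 - \<mu> * L)" using a \<mu> by (intro mult_strict_left_mono) auto
  then have r: "r < 1" "r * (1 - a) = 1 - a * (2 - \<mu> * L)"
    using a by (auto simp: r_def)
  \<comment> \<open>The value \<open>1 / 2\<close> secures \<open>\<gamma> > 0\<close> whatever the
    signs of the other two.\<close>
  define \<gamma> where "\<gamma> = max (max r (1 - \<mu> * \<eta> * c)) (1 / 2)"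
  have \<gamma>: "0 < \<gamma>" "\<gamma> < 1" "r \<le> \<gamma>" "1 - \<mu> * \<eta> * c \<le> \<gamma>"
    using r pos c by (auto simp: \<gamma>_def)
  show ?thesis
  proof (rule that[OF \<gamma>(1,2)])
    fix x y d x' y'
    assume m: "m * (norm x)\<^sup>2 \<le> x \<bullet> d" and L: "(norm d)\<^sup>2 \<le> L * (x \<bullet> d)"
      and y: "y \<in> range (\<lambda>x. B *v x)"
      and step: "x' = x - \<mu> *\<^sub>R (d + transpose B *v y)" "y' = y + \<eta> *\<^sub>R (B *v x')"
    have "(norm (x - \<mu> *\<^sub>R d))\<^sup>2 = (norm x)\<^sup>2 - 2 * \<mu> * (x \<bullet> d) + \<mu>\<^sup>2 * (norm d)\<^sup>2"
      unfolding power2_norm_eq_inner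
      by (simp add: inner_diff_left inner_diff_right inner_commute power2_eq_square algebra_simps)
    \<comment> \<open>Cocoercivity absorbs the term in \<open>d\<close>; the coefficient left on
      \<open>x \<bullet> d\<close> is negative, so strong monotonicity applies next.\<close>
    also have "\<dots> \<le> (norm x)\<^sup>2 - 2 * \<mu> * (x \<bullet> d) + \<mu>\<^sup>2 * (L * (x \<bullet> d))"
      using L by (intro add_left_mono mult_left_mono) auto
    also have "\<dots> = (norm x)\<^sup>2 - \<mu> * (2 - \<mu> * L) * (x \<bullet> d)"
      by (simp add: power2_eq_square algebra_simps)
    also have "\<dots> \<le> (norm x)\<^sup>2 - \<mu> * (2 - \<mu> * L) * (m * (norm x)\<^sup>2)"
      using m \<mu> pos by (intro diff_left_mono mult_left_mono) auto
    also have "\<dots> = r * (1 - a) * (norm x)\<^sup>2" by (simp add: r(2)) (simp add: a_def algebra_simps)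
    also have "\<dots> \<le> \<gamma> * (1 - a) * (norm x)\<^sup>2"
      using \<gamma> a by (intro mult_right_mono) auto
    finally have x_part: "(norm (x - \<mu> *\<^sub>R d))\<^sup>2 \<le> \<gamma> * (1 - a) * (norm x)\<^sup>2" .
    have "\<mu> / \<eta> * (norm y)\<^sup>2 - \<mu>\<^sup>2 * (norm (transpose B *v y))\<^sup>2
        \<le> \<mu> / \<eta> * (norm y)\<^sup>2 - \<mu>\<^sup>2 * (c * (norm y)\<^sup>2)"
      using c(2)[OF y] by (intro diff_left_mono mult_left_mono) auto
    also have "\<dots> = (1 - \<mu> * \<eta> * c) * (\<mu> / \<eta> * (norm y)\<^sup>2)"
      using pos by (simp add: field_simps power2_eq_square)
    also have "\<dots> \<le> \<gamma> * (\<mu> / \<eta> * (norm y)\<^sup>2)"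
      using \<gamma> pos by (intro mult_right_mono) auto
    finally have "lyapunov B \<mu> \<eta> x' y'
        \<le> \<gamma> * (1 - a) * (norm x)\<^sup>2 + \<gamma> * (\<mu> / \<eta> * (norm y)\<^sup>2)"
      using lyapunov_step[OF pos(1,2) step] x_part by linarith
    also have "\<dots> = \<gamma> * ((1 - \<mu> * m) * (norm x)\<^sup>2 + \<mu> / \<eta> * (norm y)\<^sup>2)"
      by (simp add: a_def algebra_simps)
    also have "\<dots> \<le> \<gamma> * lyapunov B \<mu> \<eta> x y"
      using \<gamma> lyapunov_lower[OF pos(1,2) _ \<eta> B, of x y] a
      by (intro mult_left_mono) (auto simp: a_def)
    finally show "lyapunov B \<mu> \<eta> x' y' \<le> \<gamma> * lyapunov B \<mu> \<eta> x y" .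
  qed
qed

text \<open>Subtracting the penalty lowers the strong convexity constant by at most
  \<open>\<eta> * (sigma_max B)\<^sup>2\<close> and the upper curvature by at least
  \<open>\<eta> * sigma_min_sq B\<close>.\<close>

lemma penalized_gradient_bounds:
  fixes B :: "real ^ 'm ^ 'e" and J :: "real ^ 'm \<Rightarrow> real" and b :: "real ^ 'e"
  assumes smooth: "smooth_with \<delta> J" and convex: "strongly_convex_with \<nu> J"
    and "0 < \<eta>" and \<eta>: "\<eta> * (sigma_max B)\<^sup>2 < \<nu>"
  defines "g \<equiv> \<lambda>x. gradient J x - \<eta> *\<^sub>R (transpose B *v (B *v x - b))"
    and "m \<equiv> \<nu> - \<eta> * (sigma_max B)\<^sup>2" and "L \<equiv> \<delta> - \<eta> * sigma_min_sq B"
  shows "m \<le> L"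
    and "m * (norm (x - y))\<^sup>2 \<le> (x - y) \<bullet> (g x - g y)"
    and "(norm (g x - g y))\<^sup>2 \<le> L * ((x - y) \<bullet> (g x - g y))"
proof -
  have inner_g: "(x - y) \<bullet> (g x - g y) =
      (x - y) \<bullet> (gradient J x - gradient J y) - \<eta> * (norm (B *v (x - y)))\<^sup>2" for x y
  proof -
    have "g x - g y = (gradient J x - gradient J y) - \<eta> *\<^sub>R (transpose B *v (B *v (x - y)))"
      by (simp add: g_def matrix_vector_mult_diff_distrib algebra_simps)
    moreover have "(x - y) \<bullet> (transpose B *v (B *v (x - y))) = (norm (B *v (x - y)))\<^sup>2"
      by (simp only: inner_commute[of "x - y"] transpose_mult_inner power2_norm_eq_inner)
    ultimately show ?thesis by (simp only: inner_diff_right inner_scaleR_right)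
  qed
  have lower: "m * (norm (x - y))\<^sup>2 \<le> (x - y) \<bullet> (g x - g y)" for x y
  proof -
    have "\<nu> * (norm (x - y))\<^sup>2 \<le> (x - y) \<bullet> (gradient J x - gradient J y)"
      using convex by (simp add: strongly_convex_with_def)
    moreover have "\<eta> * (norm (B *v (x - y)))\<^sup>2 \<le> \<eta> * ((sigma_max B)\<^sup>2 * (norm (x - y))\<^sup>2)"
      using sigma_bounds(2)[of B "x - y"] \<open>0 < \<eta>\<close> by (intro mult_left_mono) auto
    ultimately show ?thesis unfolding inner_g m_def left_diff_distrib by simp
  qed
  have upper: "(x - y) \<bullet> (g x - g y) \<le> L * (norm (x - y))\<^sup>2" for x y
  proof -
    have "(x - y) \<bullet> (gradient J x - gradient J y)
        \<le> norm (x - y) * norm (gradient J x - gradient J y)" by (rule norm_cauchy_schwarz)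
    also have "\<dots> \<le> norm (x - y) * (\<delta> * norm (x - y))"
      using smooth by (intro mult_left_mono) (auto simp: smooth_with_def)
    finally have "(x - y) \<bullet> (gradient J x - gradient J y) \<le> \<delta> * (norm (x - y))\<^sup>2"
      by (simp add: power2_eq_square algebra_simps)
    moreover have "\<eta> * (sigma_min_sq B * (norm (x - y))\<^sup>2) \<le> \<eta> * (norm (B *v (x - y)))\<^sup>2"
      using sigma_bounds(1)[of B "x - y"] \<open>0 < \<eta>\<close> by (intro mult_left_mono) auto
    ultimately show ?thesis unfolding inner_g L_def left_diff_distrib by simp
  qed
  \<comment> \<open>A unit vector tested against 0 squeezes \<open>m\<close> below
    \<open>L\<close>.\<close>
  obtain e :: "real ^ 'm" where "norm e = 1" using vector_choose_size[of 1] by auto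
  with lower[of e 0] upper[of e 0] show mL: "m \<le> L" by simp
  have "0 < m" using \<eta> by (simp add: m_def)
  show "m * (norm (x - y))\<^sup>2 \<le> (x - y) \<bullet> (g x - g y)" by (rule lower)
  show "(norm (g x - g y))\<^sup>2 \<le> L * ((x - y) \<bullet> (g x - g y))"
  proof (rule gderiv_cocoercive[where f = "\<lambda>x. J x - \<eta> / 2 * ((B *v x - b) \<bullet> (B *v x - b))"])
    show "0 < L" using \<open>0 < m\<close> mL by simp
    show "0 \<le> (x - y) \<bullet> (g x - g y)" for x y
      using lower[of x y] \<open>0 < m\<close> by (meson mult_nonneg_nonneg less_imp_le zero_le_power2 order_trans)
    show "(x - y) \<bullet> (g x - g y) \<le> L * (norm (x - y))\<^sup>2" for x y by (rule upper)
    show "GDERIV (\<lambda>x. J x - \<eta> / 2 * ((B *v x - b) \<bullet> (B *v x - b))) x :> g x" for x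
    proof -
      have J: "(J has_derivative (\<lambda>h. h \<bullet> gradient J x)) (at x)"
        using gderiv_gradient[of J x] smooth
        by (simp add: gderiv_def differentiable_on_def smooth_with_def)
      have "((\<lambda>x. B *v x) has_derivative (\<lambda>h. B *v h)) (at x)"
        by (rule bounded_linear_imp_has_derivative[OF matrix_vector_mul_bounded_linear])
      note D = J this
      have "((\<lambda>x. J x - \<eta> / 2 * ((B *v x - b) \<bullet> (B *v x - b))) has_derivative
        (\<lambda>h. h \<bullet> gradient J x - \<eta> / 2 * ((B *v x - b) \<bullet> (B *v h) + (B *v h) \<bullet> (B *v x - b)))) (at x)"
        by (rule derivative_eq_intros D refl)+ (simp add: fun_eq_iff)
      moreover have "h \<bullet> g x = h \<bullet> gradient J x - \<eta> * ((B *v x - b) \<bullet> (B *v h))" for h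
        unfolding g_def inner_diff_right[of h "gradient J x"] inner_scaleR_right
        by (simp only: inner_commute[of h "transpose B *v _"] transpose_mult_inner)
      ultimately show ?thesis by (simp add: gderiv_def inner_commute[of "B *v _"])
    qed
  qed
qed

(* The iterates start at index -1; here w n and l n stand for the iterates of index n - 1,
   so the pair of index i is w (Suc i), l (Suc i). *)
theorem corollary1:
  fixes B :: "real ^ 'm ^ 'e" and b :: "real ^ 'e"
    and J :: "real ^ 'm \<Rightarrow> real" and \<delta> \<nu> \<mu>w \<mu>l :: real
    and ws :: "real ^ 'm" and w :: "nat \<Rightarrow> real ^ 'm" and l :: "nat \<Rightarrow> real ^ 'e"
  assumes B_nonzero: "B \<noteq> 0"
    and feasible: "{x. B *v x = b} \<noteq> {}"
    and differentiable: "J differentiable_on UNIV"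
    and smooth: "smooth_with \<delta> J"
    and strongly_convex: "strongly_convex_with \<nu> J"
    and solution: "constrained_minimizer J B b ws"
    and step_pos: "\<mu>w > 0" "\<mu>l > 0"
    and step_w: "\<mu>w < 1 / (\<delta> - \<mu>l * sigma_min_sq B)"
    and step_l: "\<mu>l \<le> \<nu> / (2 * (sigma_max B)\<^sup>2)"
    and l_init: "l 0 = 0"
    and w_step: "\<And>n. w (Suc n) = w n - \<mu>w *\<^sub>R (gradient J (w n) + transpose B *v l n)"
    and l_step: "\<And>n. l (Suc n) = l n + \<mu>l *\<^sub>R (B *v w n - b)"
  shows "\<exists>lb. optimal_dual J B b ws lb \<and> lb \<in> range (\<lambda>x. B *v x) \<and>
           (\<forall>l'. optimal_dual J B b ws l' \<and> l' \<in> range (\<lambda>x. B *v x) \<longrightarrow> l' = lb) \<and>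
           (\<exists>C \<gamma>. C \<ge> 0 \<and> 0 < \<gamma> \<and> \<gamma> < 1 \<and>
              (\<forall>i. (norm (w (Suc i) - ws))\<^sup>2 + (norm (l (Suc i) - lb))\<^sup>2 \<le> C * \<gamma> ^ i))"
proof -
  define s where "s = (sigma_max B)\<^sup>2"
  define m where "m = \<nu> - \<mu>l * s"
  define L where "L = \<delta> - \<mu>l * sigma_min_sq B"
  define g where "g x = gradient J x - \<mu>l *\<^sub>R (transpose B *v (B *v x - b))" for x
  have "\<nu> > 0" using strongly_convex by (simp add: strongly_convex_with_def)
  \<comment> \<open>Division by zero yields 0, so \<open>s = 0\<close> would turn
    \<open>step_l\<close> into \<open>\<mu>l \<le> 0\<close>.\<close>
  have "s \<noteq> 0"
    using step_l step_pos by (auto simp: s_def)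
  then have "s > 0" by (simp add: s_def)
  then have "\<mu>l * s \<le> \<nu> / 2" using step_l by (simp add: s_def field_simps)
  \<comment> \<open>The factor 2 in \<open>step_l\<close> enters here: \<open>m\<close> keeps at
    least \<open>\<nu> / 2\<close>, which dominates \<open>\<mu>l * s\<close>.\<close>
  then have m: "0 < m" "\<mu>l * s \<le> m" "\<mu>l * s < \<nu>" using \<open>\<nu> > 0\<close> by (simp_all add: m_def)
  note bounds = penalized_gradient_bounds[OF smooth strongly_convex step_pos(2)
      m(3)[unfolded s_def], folded s_def, folded m_def L_def]
  have mL: "m \<le> L" by (rule bounds(1))
  have g_bounds: "m * (norm (x - y))\<^sup>2 \<le> (x - y) \<bullet> (g x - g y)"
    "(norm (g x - g y))\<^sup>2 \<le> L * ((x - y) \<bullet> (g x - g y))" for x y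
    unfolding g_def by (rule bounds)+
  have "0 < L" using m(1) mL by simp
  then have \<mu>L: "\<mu>w * L < 1" using step_w by (simp add: L_def[symmetric] field_simps)
  have B_upper: "(norm (B *v x))\<^sup>2 \<le> s * (norm x)\<^sup>2" for x
    unfolding s_def by (rule sigma_bounds(2))
  obtain lb where lb: "optimal_dual J B b ws lb" "lb \<in> range (\<lambda>x. B *v x)"
    by (rule optimal_dual_in_range_exists[OF differentiable solution])
  then have opt: "gradient J ws + transpose B *v lb = 0" "B *v ws = b"
    by (simp_all add: optimal_dual_def)
  obtain \<gamma> where \<gamma>: "0 < \<gamma>" "\<gamma> < 1"
    and contraction: "\<And>x y d x' y'. \<lbrakk>m * (norm x)\<^sup>2 \<le> x \<bullet> d; (norm d)\<^sup>2 \<le> L * (x \<bullet> d);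
        y \<in> range (\<lambda>x. B *v x); x' = x - \<mu>w *\<^sub>R (d + transpose B *v y);
        y' = y + \<mu>l *\<^sub>R (B *v x')\<rbrakk> \<Longrightarrow> lyapunov B \<mu>w \<mu>l x' y' \<le> \<gamma> * lyapunov B \<mu>w \<mu>l x y"
    by (rule lyapunov_contraction[OF step_pos m(1) mL \<mu>L m(2) B_upper]) blast
  \<comment> \<open>The dual iterates start at 0 and, as \<open>b = B *v ws\<close>, every increment
    lies in the range of \<open>B\<close>.\<close>
  have l_range: "l n \<in> range (\<lambda>x. B *v x)" for n
  proof (induction n)
    case 0
    show ?case unfolding l_init by (rule subspace_0[OF subspace_range_mult])
  next
    case (Suc n)
    have "B *v w n - b = B *v (w n - ws)" by (simp add: matrix_vector_mult_diff_distrib opt)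
    then have "l (Suc n) = l n + \<mu>l *\<^sub>R (B *v (w n - ws))" by (simp only: l_step)
    then show ?case
      using Suc by (simp only: subspace_add subspace_scale subspace_range_mult rangeI)
  qed
  \<comment> \<open>\<open>w n\<close> is paired with \<open>l (Suc n)\<close>, the dual iterate
    that already contains the residual of \<open>w n\<close>.\<close>
  define V where "V n = lyapunov B \<mu>w \<mu>l (w n - ws) (l (Suc n) - lb)" for n
  have V_step: "V (Suc n) \<le> \<gamma> * V n" for n
    unfolding V_def
  proof (rule contraction[where d = "g (w n) - g ws"])
    show "l (Suc n) - lb \<in> range (\<lambda>x. B *v x)"
      by (rule subspace_diff[OF subspace_range_mult l_range lb(2)])
    \<comment> \<open>Expressing \<open>l n\<close> through \<open>l (Suc n)\<close> turns the
      gradient of \<open>J\<close> into \<open>g\<close>; the optimality condition at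
      \<open>ws\<close> is then subtracted.\<close>
    have "gradient J (w n) + transpose B *v l n
        = g (w n) - g ws + transpose B *v (l (Suc n) - lb)"
      using opt by (simp add: g_def l_step matrix_vector_mult_diff_distrib
          matrix_vector_right_distrib matrix_vector_mult_scaleR eq_neg_iff_add_eq_0[symmetric])
    then show "w (Suc n) - ws
        = w n - ws - \<mu>w *\<^sub>R (g (w n) - g ws + transpose B *v (l (Suc n) - lb))"
      by (simp add: w_step)
    show "l (Suc (Suc n)) - lb = l (Suc n) - lb + \<mu>l *\<^sub>R (B *v (w (Suc n) - ws))"
      by (simp add: l_step[of "Suc n"] matrix_vector_mult_diff_distrib opt)
  qed (rule g_bounds)+
  have V_decay: "V n \<le> \<gamma> ^ n * V 0" for n
  proof (induction n)
    case (Suc n)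
    have "V (Suc n) \<le> \<gamma> * V n" by (rule V_step)
    also have "\<dots> \<le> \<gamma> * (\<gamma> ^ n * V 0)" using Suc \<gamma> by (intro mult_left_mono) auto
    finally show ?case by (simp add: mult.assoc)
  qed simp
  define k where "k = 1 - \<mu>w * m"
  have "\<mu>w * m \<le> \<mu>w * L" using mL step_pos by simp
  with \<mu>L have "k > 0" unfolding k_def by linarith
  have V_lower: "k * (norm (w n - ws))\<^sup>2 + \<mu>w / \<mu>l * (norm (l (Suc n) - lb))\<^sup>2 \<le> V n" for n
    unfolding V_def k_def
    by (rule lyapunov_lower[OF step_pos _ m(2) B_upper]) (use \<open>k > 0\<close> in \<open>simp add: k_def\<close>)
  have V_parts: "(norm (w n - ws))\<^sup>2 \<le> V n / k" "(norm (l (Suc n) - lb))\<^sup>2 \<le> V n * (\<mu>l / \<mu>w)" for n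
  proof -
    have "0 \<le> k * (norm (w n - ws))\<^sup>2" "0 \<le> \<mu>w / \<mu>l * (norm (l (Suc n) - lb))\<^sup>2"
      using \<open>k > 0\<close> step_pos by simp_all
    with V_lower[of n] have "k * (norm (w n - ws))\<^sup>2 \<le> V n"
      "\<mu>w / \<mu>l * (norm (l (Suc n) - lb))\<^sup>2 \<le> V n" by linarith+
    then show "(norm (w n - ws))\<^sup>2 \<le> V n / k" "(norm (l (Suc n) - lb))\<^sup>2 \<le> V n * (\<mu>l / \<mu>w)"
      using \<open>k > 0\<close> step_pos by (simp_all add: field_simps)
  qed
  have "V 0 \<ge> 0"
    using order_trans[OF zero_le_power2 V_parts(1)[of 0]] \<open>k > 0\<close> by (simp add: zero_le_divide_iff)
  define C where "C = V 0 / k + V 0 * (\<mu>l / \<mu>w)"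
  have "C \<ge> 0" using \<open>V 0 \<ge> 0\<close> \<open>k > 0\<close> step_pos by (simp add: C_def)
  moreover have "(norm (w (Suc i) - ws))\<^sup>2 + (norm (l (Suc i) - lb))\<^sup>2 \<le> C * \<gamma> ^ i" for i
  proof -
    \<comment> \<open>The primal error of index \<open>Suc i\<close> belongs to
      \<open>V (Suc i)\<close>, the dual one to \<open>V i\<close>; one factor
      \<open>\<gamma>\<close> is given up to align them.\<close>
    have "\<gamma> * (\<gamma> ^ i * V 0) \<le> 1 * (\<gamma> ^ i * V 0)"
      using \<gamma> \<open>V 0 \<ge> 0\<close> by (intro mult_right_mono) auto
    then have "V (Suc i) \<le> \<gamma> ^ i * V 0" using V_decay[of "Suc i"] by (simp add: mult.assoc)
    then have "V (Suc i) / k \<le> \<gamma> ^ i * V 0 / k"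
      using \<open>k > 0\<close> by (intro divide_right_mono) auto
    moreover have "V i * (\<mu>l / \<mu>w) \<le> \<gamma> ^ i * V 0 * (\<mu>l / \<mu>w)"
      using V_decay step_pos by (intro mult_right_mono) auto
    ultimately have "(norm (w (Suc i) - ws))\<^sup>2 + (norm (l (Suc i) - lb))\<^sup>2
        \<le> \<gamma> ^ i * V 0 / k + \<gamma> ^ i * V 0 * (\<mu>l / \<mu>w)"
      using V_parts(1)[of "Suc i"] V_parts(2)[of i] by linarith
    also have "\<dots> = C * \<gamma> ^ i" by (simp add: C_def algebra_simps)
    finally show ?thesis .
  qed
  ultimately show ?thesis
    using lb \<gamma> optimal_dual_in_range_unique[OF _ _ lb] by blast
qed

end
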